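(* Step 2 of tPLDCA terminates within finitely many inner iterations. That is, at every iteration $k\in\mathbb{N}$ of tPLDCA (with current iterate $x_k$, vector $u_k$ found in Step 1, and inner iterates $z_{-1}=x_k$ and $(z_i)_{i\in\mathbb{N}}$ generated by $T_g(x_k,u_k,\lambda)$), there exists $N_k\in\{-1\}\cup\mathbb{N}$ such that $z_{N_k}$ satisfies simultaneously $$g(x_k)-g(z_{N_k})-\langle u_k,x_k-z_{N_k}\rangle\ \ge\ \frac{1-\sigma}{\lambda}\|z_{N_k}-x_k\|^2$$ and $$\mathrm{dist}\left(u_k,\partial_{\zeta_k}g(z_{N_k})\right)\ \le\ \theta\|z_{N_k}-x_k\|.$$
   Context: Notation: $\mathbb{N}=\{0,1,2,\dots\}$; $\langle\cdot,\cdot\rangle$ and $\|\cdot\|$ are the inner product and Euclidean norm on $\mathbb{R}^n$. $\Gamma_0(\mathbb{R}^n)$ is the set of proper, lower semicontinuous, convex functions $\mathbb{R}^n\to\mathbb{R}\cup\{+\infty\}$; $\mathrm{dom}\,\phi=\{x:\phi(x)<+\infty\}$. For $\phi\in\Gamma_0(\mathbb{R}^n)$, $x\in\mathrm{dom}\,\phi$, $\epsilon>0$: $\partial\phi(x)=\{s:\phi(y)\ge\phi(x)+\langle s,y-x\rangle\ \forall y\in\mathbb{R}^n\}$ and $\partial_\epsilon\phi(x)=\{s:\phi(y)\ge\phi(x)+\langle s,y-x\rangle-\epsilon\ \forall y\in\mathbb{R}^n\}$; for $\epsilon=0$, $\partial_0\phi=\partial\phi$. For a nonempty closed set $S$, $\mathrm{dist}(x,S)=\min_{y\in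 S}\|x-y\|$. Standing assumptions: $g,h\in\Gamma_0(\mathbb{R}^n)$, $f=g-h$, and (1) $\inf_{x\in\mathbb{R}^n} f(x)>-\infty$; (2) $\mathrm{dom}\,h=\mathbb{R}^n$; (3) $g=g_0+\iota_C$, where $g_0\in\Gamma_0(\mathbb{R}^n)$ has $\mathrm{dom}\,g_0=\mathbb{R}^n$, $C\subset\mathbb{R}^n$ is nonempty closed convex, and $\iota_C$ is $0$ on $C$ and $+\infty$ elsewhere; (4) there is an inner iterative algorithm $T_g$ such that for any $(x_k,u_k,\lambda_k)\in\mathrm{dom}\,g\times\mathbb{R}^n\times(0,\infty)$, $T_g(x_k,u_k,\lambda_k)$ generates a sequence $(z_i)_{i\in\mathbb{N}}$ in $\mathrm{dom}\,g$ converging to a solution $\bar z_k\in\mathrm{dom}\,g$ of the proximal point subproblem (PP): minimize over $z\in\mathbb{R}^n$ the function $\tilde f_k(z)=g(z)-\langle u_k,z-x_k\rangle+\frac{1}{2\lambda_k}\|z-x_k\|^2$; i.e. $0\in\partial\tilde f_k(\bar z_k)=\partial g(\bar z_k)-u_k+\frac{1}{\lambda_k}(\bar z_k-x_k)$. Algorithm tPLDCA. Parameters: $\sigma\in(0,1)$, $\lambda>0$, $\theta>\frac1\lambda$, $\rho\in[0,\frac{1-\sigma}{\lambda})$, $\gamma\in[0,\frac{1-\sigma}{\lambda}-\rho)$, $\lambda_k=\lambda$ for all $k\in\mathbb{N}$, and positive numbers $(\zeta_k)_{k\in\mathbb{N}}$ with $\zeta_k\to0$. Start with $x_{-1},x_0\in\mathrm{dom}\,f=\{x:f(x)<+\infty\}$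 and for $k=0,1,2,\dots$ do: Step 1: find $u_k\in\mathbb{R}^n$ with $\mathrm{dist}(u_k,\partial_{\epsilon_k}h(x_k))\le d_k$, where $\epsilon_k=\rho\|x_k-x_{k-1}\|^2$ and $d_k=\gamma\|x_k-x_{k-1}\|$. Step 2: set $z_{-1}=x_k$ and generate $z_0,z_1,\dots$ by $T_g(x_k,u_k,\lambda_k)$ until, for some $i\in\{-1\}\cup\mathbb{N}$, both $g(x_k)-g(z_i)-\langle u_k,x_k-z_i\rangle\ge\frac{1-\sigma}{\lambda_k}\|z_i-x_k\|^2$ and $\mathrm{dist}(u_k,\partial_{\zeta_k}g(z_i))\le\theta\|z_i-x_k\|$ hold; then set $x_{k+1}=z_i$. *)

theory Defs
  imports "HOL-Analysis.Analysis"
begin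

definition edom :: "('a \<Rightarrow> ereal) \<Rightarrow> 'a set" where
  "edom \<phi> = {x. \<phi> x < \<infinity>}"

definition proper_fun :: "('a \<Rightarrow> ereal) \<Rightarrow> bool" where
  "proper_fun \<phi> \<longleftrightarrow> (\<forall>x. \<phi> x \<noteq> -\<infinity>) \<and> edom \<phi> \<noteq> {}"

definition lsc_fun :: "('a::topological_space \<Rightarrow> ereal) \<Rightarrow> bool" where
  "lsc_fun \<phi> \<longleftrightarrow> (\<forall>x. \<phi> x \<le> Liminf (at x) \<phi>)"

definition convex_fun :: "('a::real_vector \<Rightarrow> ereal) \<Rightarrow> bool" where
  "convex_fun \<phi> \<longleftrightarrow> (\<forall>x y t. 0 < t \<and> t < 1 \<longrightarrow>
     \<phi> ((1 - t) *\<^sub>R x + t *\<^sub>R y) \<le> ereal (1 - t) * \<phi> x + ereal t * \<phi> y)"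

definition Gamma0 :: "('a::real_normed_vector \<Rightarrow> ereal) set" where
  "Gamma0 = {\<phi>. proper_fun \<phi> \<and> lsc_fun \<phi> \<and> convex_fun \<phi>}"

definition indicator_ext :: "'a set \<Rightarrow> 'a \<Rightarrow> ereal" where
  "indicator_ext C x = (if x \<in> C then 0 else \<infinity>)"

text \<open>For \<open>\<epsilon> = 0\<close> this is the ordinary subdifferential; it is empty outside the domain of a proper
  \<open>\<phi>\<close>.\<close>

definition eps_subdiff :: "('a::real_inner \<Rightarrow> ereal) \<Rightarrow> real \<Rightarrow> 'a \<Rightarrow> 'a set" where
  "eps_subdiff \<phi> \<epsilon> x = {s. \<forall>y. \<phi> y \<ge> \<phi> x + ereal (s \<bullet> (y - x)) - ereal \<epsilon>}"

text \<open>The library sets \<open>infdist x {} = 0\<close>, which would make an upper bound on the distance to an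
  empty set vacuous; here that distance is \<open>\<infinity>\<close>.\<close>

definition edist_set :: "'a::metric_space \<Rightarrow> 'a set \<Rightarrow> ereal" where
  "edist_set x S = (if S = {} then \<infinity> else ereal (infdist x S))"

definition prox_obj ::
  "('a::real_inner \<Rightarrow> ereal) \<Rightarrow> 'a \<Rightarrow> 'a \<Rightarrow> real \<Rightarrow> 'a \<Rightarrow> ereal" where
  "prox_obj g xk uk l z =
     g z - ereal (uk \<bullet> (z - xk)) + ereal (1 / (2 * l) * (norm (z - xk))\<^sup>2)"

definition PP_solution ::
  "('a::real_inner \<Rightarrow> ereal) \<Rightarrow> 'a \<Rightarrow> 'a \<Rightarrow> real \<Rightarrow> 'a \<Rightarrow> bool" where
  "PP_solution g xk uk l zbar \<longleftrightarrow>
     zbar \<in> edom g \<and> (\<forall>z. prox_obj g xk uk l zbar \<le> prox_obj g xk uk l z)"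

text \<open>An inner algorithm maps \<open>(x\<^sub>k, u\<^sub>k, \<lambda>\<^sub>k)\<close> to the sequence \<open>(z\<^sub>i)\<close>, \<open>i \<in> \<nat>\<close>.\<close>

definition inner_algorithm ::
  "('a::real_inner \<Rightarrow> ereal) \<Rightarrow> ('a \<Rightarrow> 'a \<Rightarrow> real \<Rightarrow> nat \<Rightarrow> 'a) \<Rightarrow> bool" where
  "inner_algorithm g Tg \<longleftrightarrow>
     (\<forall>xk\<in>edom g. \<forall>uk. \<forall>l>0.
        (\<forall>i. Tg xk uk l i \<in> edom g) \<and>
        (\<exists>zbar. PP_solution g xk uk l zbar \<and> Tg xk uk l \<longlonglongrightarrow> zbar))"

text \<open>The inner iterates including \<open>z\<^bsub>-1\<^esub> = x\<^sub>k\<close>; only indices \<open>i \<ge> -1\<close> are meant.\<close>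

definition inner_iterate ::
  "('a \<Rightarrow> 'a \<Rightarrow> real \<Rightarrow> nat \<Rightarrow> 'a) \<Rightarrow> 'a \<Rightarrow> 'a \<Rightarrow> real \<Rightarrow> int \<Rightarrow> 'a" where
  "inner_iterate Tg xk uk l i = (if i = -1 then xk else Tg xk uk l (nat i))"

text \<open>The test of Step 1 at iteration \<open>k\<close>.  The outer iterates \<open>x\<close> are indexed by the integers from
  \<open>-1\<close> on.\<close>

definition step1 ::
  "('a::real_inner \<Rightarrow> ereal) \<Rightarrow> real \<Rightarrow> real \<Rightarrow> (int \<Rightarrow> 'a) \<Rightarrow> (nat \<Rightarrow> 'a) \<Rightarrow> nat \<Rightarrow> bool" where
  "step1 h \<rho> \<gamma> x u k \<longleftrightarrow>
     edist_set (u k)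
       (eps_subdiff h (\<rho> * (norm (x (int k) - x (int k - 1)))\<^sup>2) (x (int k)))
     \<le> ereal (\<gamma> * norm (x (int k) - x (int k - 1)))"

definition stop_test ::
  "('a::real_inner \<Rightarrow> ereal) \<Rightarrow> real \<Rightarrow> real \<Rightarrow> real \<Rightarrow> real \<Rightarrow> 'a \<Rightarrow> 'a \<Rightarrow> 'a \<Rightarrow> bool" where
  "stop_test g \<sigma> l \<theta> \<zeta>k xk uk z \<longleftrightarrow>
     g xk - g z - ereal (uk \<bullet> (xk - z)) \<ge> ereal ((1 - \<sigma>) / l * (norm (z - xk))\<^sup>2) \<and>
     edist_set uk (eps_subdiff g \<zeta>k z) \<le> ereal (\<theta> * norm (z - xk))"

text \<open>Step 2 at iteration \<open>k\<close> stops at the first inner index passing the test.\<close>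

definition step2 ::
  "('a::real_inner \<Rightarrow> ereal) \<Rightarrow> ('a \<Rightarrow> 'a \<Rightarrow> real \<Rightarrow> nat \<Rightarrow> 'a) \<Rightarrow> real \<Rightarrow> real \<Rightarrow> real \<Rightarrow>
   (nat \<Rightarrow> real) \<Rightarrow> (int \<Rightarrow> 'a) \<Rightarrow> (nat \<Rightarrow> 'a) \<Rightarrow> nat \<Rightarrow> bool" where
  "step2 g Tg \<sigma> l \<theta> \<zeta> x u k \<longleftrightarrow>
     (let z = inner_iterate Tg (x (int k)) (u k) l;
          ok = (\<lambda>i. stop_test g \<sigma> l \<theta> (\<zeta> k) (x (int k)) (u k) (z i))
      in \<exists>i\<ge>-1. ok i \<and> (\<forall>j. -1 \<le> j \<and> j < i \<longrightarrow> \<not> ok j) \<and> x (int k + 1) = z i)"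

text \<open>A run of the algorithm that has reached Step 2 of iteration \<open>k\<close>: Step 2 has terminated in all
  earlier iterations, and \<open>u\<^sub>k\<close> has been found; nothing is said about later values of \<open>x\<close> and \<open>u\<close>.\<close>

definition tPLDCA_reaches ::
  "('a::real_inner \<Rightarrow> ereal) \<Rightarrow> ('a \<Rightarrow> ereal) \<Rightarrow> ('a \<Rightarrow> 'a \<Rightarrow> real \<Rightarrow> nat \<Rightarrow> 'a) \<Rightarrow>
   real \<Rightarrow> real \<Rightarrow> real \<Rightarrow> real \<Rightarrow> real \<Rightarrow> (nat \<Rightarrow> real) \<Rightarrow> (int \<Rightarrow> 'a) \<Rightarrow> (nat \<Rightarrow> 'a) \<Rightarrow> nat \<Rightarrow> bool" where
  "tPLDCA_reaches g h Tg \<sigma> l \<theta> \<rho> \<gamma> \<zeta> x u k \<longleftrightarrow>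
     x (-1) \<in> edom (\<lambda>y. g y - h y) \<and> x 0 \<in> edom (\<lambda>y. g y - h y) \<and>
     (\<forall>j\<le>k. step1 h \<rho> \<gamma> x u j) \<and>
     (\<forall>j<k. step2 g Tg \<sigma> l \<theta> \<zeta> x u j)"

end

theory Submission
  imports Defs
begin

text \<open>
  Optimality of the proximal point \<open>z\<close> says that \<open>s = u + (x - z) / \<lambda>\<close> is a subgradient of \<open>g\<close>
  at \<open>z\<close>.  If \<open>z = x\<close>, then \<open>s = u\<close> and the index \<open>-1\<close> already passes both tests.  Otherwise, in the
  limit \<open>z\<^sub>i \<longlonglongrightarrow> z\<close>, both tests hold strictly: the first because \<open>1 - \<sigma> < 1\<close>, the second because
  \<open>norm (s - u) = norm (z - x) / \<lambda> < \<theta> * norm (z - x)\<close>.  Since \<open>g\<close> is continuous relative to \<open>C\<close>,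
  \<open>s\<close> is a \<open>\<zeta>\<^sub>k\<close>-subgradient at \<open>z\<^sub>i\<close> and the first test holds at \<open>z\<^sub>i\<close> for all large \<open>i\<close>.
\<close>

lemma Gamma0_finite:
  assumes "\<phi> \<in> Gamma0" "y \<in> edom \<phi>"
  shows "\<phi> y = ereal (real_of_ereal (\<phi> y))"
  using assms by (cases "\<phi> y") (auto simp: Gamma0_def proper_fun_def edom_def)

lemma Gamma0_not_MInf: "\<phi> \<in> Gamma0 \<Longrightarrow> \<phi> y \<noteq> -\<infinity>"
  by (auto simp: Gamma0_def proper_fun_def)

text \<open>A finite convex function on a finite-dimensional space is continuous. Applied to
  \<open>g0\<close>, this yields convergence of the values of \<open>g\<close> along the inner
  iterates.\<close>

lemma Gamma0_continuous_on_UNIV: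
  fixes \<phi> :: "'a::euclidean_space \<Rightarrow> ereal"
  assumes \<phi>: "\<phi> \<in> Gamma0" and dom: "edom \<phi> = UNIV"
  shows "continuous_on UNIV (\<lambda>y. real_of_ereal (\<phi> y))"
proof (rule convex_on_continuous)
  have fin: "\<phi> y = ereal (real_of_ereal (\<phi> y))" for y
    using Gamma0_finite[OF \<phi>] dom by blast
  show "convex_on UNIV (\<lambda>y. real_of_ereal (\<phi> y))"
  proof (rule convex_onI)
    fix t :: real and a b :: 'a
    assume t: "0 < t" "t < 1"
    have "\<phi> ((1 - t) *\<^sub>R a + t *\<^sub>R b) \<le> ereal (1 - t) * \<phi> a + ereal t * \<phi> b"
      using \<phi> t by (auto simp: Gamma0_def convex_fun_def)
    then have "ereal (real_of_ereal (\<phi> ((1 - t) *\<^sub>R a + t *\<^sub>R b)))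
        \<le> ereal (1 - t) * ereal (real_of_ereal (\<phi> a)) + ereal t * ereal (real_of_ereal (\<phi> b))"
      by (simp only: fin[symmetric])
    then show "real_of_ereal (\<phi> ((1 - t) *\<^sub>R a + t *\<^sub>R b))
        \<le> (1 - t) * real_of_ereal (\<phi> a) + t * real_of_ereal (\<phi> b)"
      by simp
  qed simp
qed simp

text \<open>Fermat's rule, obtained without a sum rule for subdifferentials: minimality is tested
  only along the segment from \<open>z\<close> to \<open>y\<close>, where convexity bounds
  \<open>g\<close> linearly in \<open>t\<close> and the quadratic remainder is of order
  \<open>t^2\<close>.\<close>

lemma PP_solution_subgradient:
  assumes g: "g \<in> Gamma0" and "0 < l" and sol: "PP_solution g x u l z"
  shows "u + (1 / l) *\<^sub>R (x - z) \<in> eps_subdiff g 0 z"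
proof -
  define s where "s = u + (1 / l) *\<^sub>R (x - z)"
  have z: "z \<in> edom g" and min: "\<And>w. prox_obj g x u l z \<le> prox_obj g x u l w"
    using sol by (auto simp: PP_solution_def)
  obtain a where a: "g z = ereal a"
    using Gamma0_finite[OF g z] by blast
  have "g z + ereal (s \<bullet> (y - z)) - ereal 0 \<le> g y" for y
  proof (cases "g y")
    case (real b)
    define d where "d = y - z"
    have step: "0 \<le> (b - a - s \<bullet> d) + t * ((norm d)\<^sup>2 / (2 * l))" if t: "0 < t" "t < 1" for t
    proof -
      let ?w = "(1 - t) *\<^sub>R z + t *\<^sub>R y"
      have w: "?w = z + t *\<^sub>R d"
        by (simp add: d_def algebra_simps)
      have le: "g ?w \<le> ereal ((1 - t) * a + t * b)"
      proof -
        have "g ?w \<le> ereal (1 - t) * g z + ereal t * g y"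
          using g t by (auto simp: Gamma0_def convex_fun_def)
        then show ?thesis
          using real a by simp
      qed
      then obtain c where c: "g (z + t *\<^sub>R d) = ereal c"
        using Gamma0_not_MInf[OF g, of ?w] w by (cases "g ?w") auto
      have "a - u \<bullet> (z - x) + 1 / (2 * l) * (norm (z - x))\<^sup>2
          \<le> c - u \<bullet> (z + t *\<^sub>R d - x) + 1 / (2 * l) * (norm (z + t *\<^sub>R d - x))\<^sup>2"
        using min[of "z + t *\<^sub>R d"] a c by (simp add: prox_obj_def)
      moreover have "c \<le> (1 - t) * a + t * b"
        using le c w by simp
      moreover have "(norm (z + t *\<^sub>R d - x))\<^sup>2
          = (norm (z - x))\<^sup>2 + 2 * t * ((z - x) \<bullet> d) + t\<^sup>2 * (norm d)\<^sup>2"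
        unfolding power2_norm_eq_inner
        by (simp add: inner_simps inner_commute algebra_simps power2_eq_square)
      ultimately have "0 \<le> t * (b - a) - t * (u \<bullet> d)
          + 1 / (2 * l) * (2 * t * ((z - x) \<bullet> d) + t\<^sup>2 * (norm d)\<^sup>2)"
        by (simp add: inner_simps algebra_simps)
      \<comment> \<open>The cross term of the expanded square turns the slope \<open>u\<close> into
        \<open>s\<close>; a common factor \<open>t\<close> can then be cancelled.\<close>
      also have "\<dots> = t * ((b - a - s \<bullet> d) + t * ((norm d)\<^sup>2 / (2 * l)))"
        using \<open>0 < l\<close> by (simp add: s_def inner_simps field_simps power2_eq_square)
      finally show ?thesis
        using t by (simp add: zero_le_mult_iff)
    qed
    \<comment> \<open>Letting \<open>t\<close> decrease to 0 removes the quadratic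
      remainder.\<close>
    have "((\<lambda>t. (b - a - s \<bullet> d) + t * ((norm d)\<^sup>2 / (2 * l)))
        \<longlongrightarrow> (b - a - s \<bullet> d) + 0 * ((norm d)\<^sup>2 / (2 * l))) (at_right 0)"
      by (intro tendsto_intros)
    moreover have "eventually (\<lambda>t. 0 \<le> (b - a - s \<bullet> d) + t * ((norm d)\<^sup>2 / (2 * l))) (at_right 0)"
      using step by (auto simp: eventually_at_right_field intro!: exI[of _ 1])
    ultimately have "0 \<le> b - a - s \<bullet> d"
      using tendsto_lowerbound[of _ _ "at_right (0::real)"] by fastforce
    then show ?thesis
      using a real by (simp add: d_def)
  next
    case MInf
    then show ?thesis using Gamma0_not_MInf[OF g] by blast
  qed simp
  then show ?thesis
    by (simp add: eps_subdiff_def s_def)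
qed

text \<open>The affine minorant of \<open>g\<close> with slope \<open>s\<close> that touches
  \<open>g\<close> at \<open>z\<close> lies below \<open>g\<close> by exactly
  \<open>b - a - s \<bullet> (w - z)\<close> at \<open>w\<close>. Lowering the value of
  \<open>g\<close> at \<open>w\<close> by at least this gap gives a minorant through that point with
  the same slope.\<close>

lemma subgradient_transport:
  assumes s: "s \<in> eps_subdiff g 0 z" and "g z = ereal a" "g w = ereal b"
    and le: "b - a - s \<bullet> (w - z) \<le> \<epsilon>"
  shows "s \<in> eps_subdiff g \<epsilon> w"
proof -
  have "g w + ereal (s \<bullet> (y - w)) - ereal \<epsilon> \<le> g y" for y
  proof -
    have "g w + ereal (s \<bullet> (y - w)) - ereal \<epsilon> \<le> g z + ereal (s \<bullet> (y - z)) - ereal 0"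
      using assms by (simp add: inner_simps)
    also have "\<dots> \<le> g y"
      using s by (simp add: eps_subdiff_def)
    finally show ?thesis .
  qed
  then show ?thesis
    by (simp add: eps_subdiff_def)
qed

lemma edist_set_le:
  assumes "s \<in> S" "dist u s \<le> r"
  shows "edist_set u S \<le> ereal r"
  using assms infdist_le2[of s S u r] by (auto simp: edist_set_def)

text \<open>Convergence of the values is a separate hypothesis because lower semicontinuity of
  \<open>g\<close> alone bounds them only from below in the limit, while both tests need upper
  bounds on \<open>g (w i)\<close>.\<close>

lemma eventually_stop_test:
  fixes g :: "'a::real_inner \<Rightarrow> ereal"
  assumes g: "g \<in> Gamma0" and x: "x \<in> edom g"
    and par: "0 < \<sigma>" "0 < l" "\<theta> > 1 / l" "0 < \<zeta>"
    and sol: "PP_solution g x u l z" and "z \<noteq> x"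
    and w: "\<And>i. w i \<in> edom g" "w \<longlonglongrightarrow> z"
    and gw: "(\<lambda>i. real_of_ereal (g (w i))) \<longlonglongrightarrow> real_of_ereal (g z)"
  shows "eventually (\<lambda>i. stop_test g \<sigma> l \<theta> \<zeta> x u (w i)) sequentially"
proof -
  define s where "s = u + (1 / l) *\<^sub>R (x - z)"
  define a where "a = real_of_ereal (g z)"
  define b where "b = (\<lambda>i. real_of_ereal (g (w i)))"
  define c where "c = real_of_ereal (g x)"
  have z: "z \<in> edom g"
    using sol by (simp add: PP_solution_def)
  have fin: "g z = ereal a" "g x = ereal c" "\<And>i. g (w i) = ereal (b i)"
    unfolding a_def b_def c_def using Gamma0_finite[OF g] z x w by auto
  have b: "b \<longlonglongrightarrow> a"
    using gw by (simp add: a_def b_def)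
  have sub: "s \<in> eps_subdiff g 0 z"
    unfolding s_def using PP_solution_subgradient g sol par by blast
  have pos: "0 < norm (z - x)"
    using \<open>z \<noteq> x\<close> by simp
  \<comment> \<open>The subgradient inequality tested at \<open>x\<close> gives the first test at
    \<open>z\<close> with constant \<open>1 / l\<close>, so the margin is at least
    \<open>\<sigma> / l * (norm (z - x))^2\<close>.\<close>
  have "g z + ereal (s \<bullet> (x - z)) - ereal 0 \<le> g x"
    using sub unfolding eps_subdiff_def by blast
  then have "a + s \<bullet> (x - z) \<le> c"
    by (simp add: fin)
  moreover have "s \<bullet> (x - z) = u \<bullet> (x - z) + 1 / l * (norm (z - x))\<^sup>2"
    by (simp add: s_def inner_simps power2_norm_eq_inner inner_commute algebra_simps)
  moreover have "(1 - \<sigma>) / l * (norm (z - x))\<^sup>2 < 1 / l * (norm (z - x))\<^sup>2"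
    using par pos by (intro mult_strict_right_mono divide_strict_right_mono) auto
  ultimately have "(1 - \<sigma>) / l * (norm (z - x))\<^sup>2 < c - a - u \<bullet> (x - z)"
    by linarith
  then have "0 < c - a - u \<bullet> (x - z) - (1 - \<sigma>) / l * (norm (z - x))\<^sup>2"
    by simp
  moreover have "(\<lambda>i. c - b i - u \<bullet> (x - w i) - (1 - \<sigma>) / l * (norm (w i - x))\<^sup>2)
      \<longlonglongrightarrow> c - a - u \<bullet> (x - z) - (1 - \<sigma>) / l * (norm (z - x))\<^sup>2"
    by (intro tendsto_intros b w)
  ultimately have ev1: "eventually (\<lambda>i. 0 < c - b i - u \<bullet> (x - w i)
      - (1 - \<sigma>) / l * (norm (w i - x))\<^sup>2) sequentially"
    by (rule order_tendstoD(1)[rotated])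
  \<comment> \<open>This is the gap of \<open>subgradient_transport\<close> at \<open>w i\<close>.
    It tends to 0, so it eventually drops below the fixed tolerance
    \<open>\<zeta> > 0\<close>.\<close>
  have "(\<lambda>i. b i - a - s \<bullet> (w i - z)) \<longlonglongrightarrow> a - a - s \<bullet> (z - z)"
    by (intro tendsto_intros b w)
  then have ev2: "eventually (\<lambda>i. b i - a - s \<bullet> (w i - z) < \<zeta>) sequentially"
    by (rule order_tendstoD(2)) (use par in simp)
  have dist: "dist u s = 1 / l * norm (z - x)"
    using par by (simp add: s_def dist_norm norm_minus_commute)
  have "(\<lambda>i. \<theta> * norm (w i - x)) \<longlonglongrightarrow> \<theta> * norm (z - x)"
    by (intro tendsto_intros w)
  then have ev3: "eventually (\<lambda>i. dist u s < \<theta> * norm (w i - x)) sequentially"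
    by (rule order_tendstoD(1)) (unfold dist, intro mult_strict_right_mono par pos)
  show ?thesis
    using ev1 ev2 ev3
  proof eventually_elim
    case (elim i)
    \<comment> \<open>One fixed \<open>s\<close> witnesses the distance bound at all late
      iterates.\<close>
    have "s \<in> eps_subdiff g \<zeta> (w i)"
      using subgradient_transport[OF sub fin(1) fin(3)] elim by simp
    then show ?case
      using elim by (auto simp: stop_test_def fin intro: edist_set_le)
  qed
qed

lemma inner_iterate_in_edom:
  assumes "inner_algorithm g Tg" "x \<in> edom g" "0 < l"
  shows "inner_iterate Tg x u l i \<in> edom g"
  using assms by (simp add: inner_algorithm_def inner_iterate_def)

text \<open>Initially, finiteness of \<open>f\<close> from above passes to \<open>g\<close> because
  \<open>h\<close> is never infinite from above. Afterwards each outer iterate is an inner iterate,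
  and these stay in the domain of \<open>g\<close>.\<close>

lemma tPLDCA_iterate_in_edom:
  assumes "edom h = UNIV" "inner_algorithm g Tg" "0 < l"
    and reach: "tPLDCA_reaches g h Tg \<sigma> l \<theta> \<rho> \<gamma> \<zeta> x u k" and "j \<le> k"
  shows "x (int j) \<in> edom g"
  using \<open>j \<le> k\<close>
proof (induction j)
  case 0
  have "h (x 0) \<noteq> \<infinity>"
    using assms(1) by (auto simp: edom_def)
  moreover have "g (x 0) - h (x 0) < \<infinity>"
    using reach by (simp add: tPLDCA_reaches_def edom_def)
  ultimately show ?case
    by (cases "g (x 0)"; cases "h (x 0)") (auto simp: edom_def)
next
  case (Suc j)
  then have "step2 g Tg \<sigma> l \<theta> \<zeta> x u j"
    using reach by (simp add: tPLDCA_reaches_def)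
  then obtain i where "x (int j + 1) = inner_iterate Tg (x (int j)) (u j) l i"
    by (auto simp: step2_def Let_def)
  then show ?case
    using inner_iterate_in_edom[OF assms(2) _ assms(3)] Suc by (simp add: add.commute)
qed

theorem theorem4p5:
  fixes g h g0 :: "real ^ 'n \<Rightarrow> ereal"
    and C :: "(real ^ 'n) set"
    and Tg :: "real ^ 'n \<Rightarrow> real ^ 'n \<Rightarrow> real \<Rightarrow> nat \<Rightarrow> real ^ 'n"
    and \<sigma> l \<theta> \<rho> \<gamma> :: real
    and \<zeta> :: "nat \<Rightarrow> real"
    and x :: "int \<Rightarrow> real ^ 'n"
    and u :: "nat \<Rightarrow> real ^ 'n"
    and k :: nat
  assumes "g \<in> Gamma0" and "h \<in> Gamma0"
    and "(INF y. g y - h y) > -\<infinity>"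
    and "edom h = UNIV"
    and "g0 \<in> Gamma0" and "edom g0 = UNIV"
    and "C \<noteq> {}" and "closed C" and "convex C"
    and "g = (\<lambda>y. g0 y + indicator_ext C y)"
    and "inner_algorithm g Tg"
    and "0 < \<sigma>" and "\<sigma> < 1" and "0 < l" and "\<theta> > 1 / l"
    and "0 \<le> \<rho>" and "\<rho> < (1 - \<sigma>) / l"
    and "0 \<le> \<gamma>" and "\<gamma> < (1 - \<sigma>) / l - \<rho>"
    and "\<And>j. 0 < \<zeta> j" and "\<zeta> \<longlonglongrightarrow> 0"
    and "tPLDCA_reaches g h Tg \<sigma> l \<theta> \<rho> \<gamma> \<zeta> x u k"
  shows "\<exists>N\<ge>-1. let z = inner_iterate Tg (x (int k)) (u k) l N in
           g (x (int k)) - g z - ereal (u k \<bullet> (x (int k) - z))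
             \<ge> ereal ((1 - \<sigma>) / l * (norm (z - x (int k)))\<^sup>2) \<and>
           edist_set (u k) (eps_subdiff g (\<zeta> k) z) \<le> ereal (\<theta> * norm (z - x (int k)))"
proof -
  define y where "y = x (int k)"
  define w where "w = Tg y (u k) l"
  have y: "y \<in> edom g"
    unfolding y_def using tPLDCA_iterate_in_edom assms by blast
  obtain z where sol: "PP_solution g y (u k) l z" and w: "\<And>i. w i \<in> edom g" "w \<longlonglongrightarrow> z"
    using assms(11,14) y unfolding inner_algorithm_def w_def by blast
  have "\<exists>N\<ge>-1. stop_test g \<sigma> l \<theta> (\<zeta> k) y (u k) (inner_iterate Tg y (u k) l N)"
  proof (cases "z = y")
    case True
    obtain a where a: "g y = ereal a"
      using Gamma0_finite[OF assms(1) y] by blast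
    \<comment> \<open>With \<open>z = y\<close> the shift \<open>(1 / l) *\<^sub>R (y - z)\<close>
      vanishes, so \<open>u k\<close> itself is a subgradient; both tests at \<open>y\<close> then
      reduce to 0 against 0.\<close>
    have "u k \<in> eps_subdiff g 0 y"
      using PP_solution_subgradient[OF assms(1,14) sol] True by simp
    then have "u k \<in> eps_subdiff g (\<zeta> k) y"
      using subgradient_transport[of "u k" g y a y a "\<zeta> k"] a assms(20)[of k] by simp
    then have "stop_test g \<sigma> l \<theta> (\<zeta> k) y (u k) y"
      using a edist_set_le[of "u k" _ "u k" 0] by (simp add: stop_test_def zero_ereal_def)
    then show ?thesis
      by (intro exI[of _ "-1"]) (simp add: inner_iterate_def)
  next
    case False
    have g: "g v = g0 v" if "v \<in> edom g" for v
      using that Gamma0_not_MInf[OF assms(5), of v]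
      by (auto simp: assms(10) edom_def indicator_ext_def split: if_splits)
    \<comment> \<open>Continuity is used for \<open>g0\<close>, since \<open>g\<close> jumps to
      infinity off \<open>C\<close>. The limit and all inner iterates lie in the domain of
      \<open>g\<close>, where the two functions agree.\<close>
    have "(\<lambda>i. real_of_ereal (g0 (w i))) \<longlonglongrightarrow> real_of_ereal (g0 z)"
      using Gamma0_continuous_on_UNIV[OF assms(5,6)] w(2)
      by (auto intro: continuous_on_tendsto_compose)
    then have "(\<lambda>i. real_of_ereal (g (w i))) \<longlonglongrightarrow> real_of_ereal (g z)"
      using g w(1) sol by (simp add: PP_solution_def)
    then have "eventually (\<lambda>i. stop_test g \<sigma> l \<theta> (\<zeta> k) y (u k) (w i)) sequentially"
      using eventually_stop_test assms(1,12,14,15,20) y sol False w by blast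
    then obtain i where "stop_test g \<sigma> l \<theta> (\<zeta> k) y (u k) (w i)"
      by (auto simp: eventually_sequentially)
    then show ?thesis
      by (intro exI[of _ "int i"]) (simp add: inner_iterate_def w_def)
  qed
  then show ?thesis
    by (simp add: stop_test_def y_def Let_def)
qed

end
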